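(* Every linear $3$-graph $H$ with minimum degree $\delta(H) \geq 4$ contains a crown.
   Context: A (linear) $3$-graph $H=(V,E)$ consists of a finite vertex set $V$ and a set $E$ of $3$-element subsets of $V$ (edges) such that any two distinct edges intersect in at most one vertex. The degree $d(v)$ of a vertex $v$ is the number of edges containing $v$, and $\delta(H)$ is the minimum degree. A crown is the $3$-graph consisting of three pairwise disjoint edges (jewels) together with a fourth edge (base) that intersects each of the three jewels (necessarily in exactly one vertex each). $H$ contains a crown if some four edges of $H$ form a crown. *)

theory Defs
  imports Main
begin

definition linear_3_graph :: "'a set \<Rightarrow> 'a set set \<Rightarrow> bool" where
  "linear_3_graph V E \<longleftrightarrow>
     finite V \<and>
     (\<forall>e\<in>E. e \<subseteq> V \<and> card e = 3) \<and>
     (\<forall>e\<in>E. \<forall>f\<in>E. e \<noteq> f \<longrightarrow> card (e \<inter> f) \<le> 1)"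

definition degree :: "'a set set \<Rightarrow> 'a \<Rightarrow> nat" where
  "degree E v = card {e \<in> E. v \<in> e}"

text \<open>Only meaningful for a nonempty finite vertex set, since \<open>Min {}\<close> is unspecified.\<close>
definition min_degree :: "'a set \<Rightarrow> 'a set set \<Rightarrow> nat" where
  "min_degree V E = Min (degree E ` V)"

text \<open>The edges \<open>j1\<close>, \<open>j2\<close>, \<open>j3\<close> are the jewels and \<open>b\<close> is the base. The conditions
  force the four edges to be distinct and the base to meet each jewel in exactly one vertex.\<close>
definition crown :: "'a set set \<Rightarrow> bool" where
  "crown C \<longleftrightarrow>
     (\<exists>j1 j2 j3 b. C = {j1, j2, j3, b} \<and>
        (\<forall>e\<in>C. card e = 3) \<and>
        j1 \<inter> j2 = {} \<and> j1 \<inter> j3 = {} \<and> j2 \<inter> j3 = {} \<and>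
        b \<inter> j1 \<noteq> {} \<and> b \<inter> j2 \<noteq> {} \<and> b \<inter> j3 \<noteq> {})"

definition contains_crown :: "'a set set \<Rightarrow> bool" where
  "contains_crown E \<longleftrightarrow> (\<exists>C\<subseteq>E. crown C)"

end

theory Submission
  imports Defs
begin

text \<open>In a crown-free graph of minimum degree at least 4, three edges that leave the three vertices
  of a common base edge can never be pairwise disjoint. This forces every edge \<open>xyz\<close> to lie in a
  pencil: some vertex \<open>p\<close> is joined to \<open>x\<close>, \<open>y\<close>, \<open>z\<close> by edges \<open>xpa\<close>, \<open>ypb\<close>, \<open>zpc\<close>. Applying the
  same principle to the edges of the pencil shows that \<open>yac\<close>, \<open>zab\<close>, \<open>xbc\<close> are edges as well, so the
  seven vertices span a Fano plane. Each point of that plane lies on a further edge; any two of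
  these meet outside the plane, since the line through their points can serve as a base. Seven
  pairwise intersecting pairs form a star, and an edge of the star is the base of a crown.\<close>

section \<open>Crown-free linear 3-graphs, with edges as vertex triples\<close>

locale crown_free =
  fixes V :: "'a set" and E :: "'a set set"
  assumes linear: "linear_3_graph V E"
    and min_deg: "v \<in> V \<Longrightarrow> 4 \<le> degree E v"
    and no_crown: "\<not> contains_crown E"
begin

text \<open>The ordered form turns intersections of edges into equations between vertices.\<close>

definition T :: "'a \<Rightarrow> 'a \<Rightarrow> 'a \<Rightarrow> bool" where
  "T u v w \<longleftrightarrow> {u, v, w} \<in> E"

definition adj :: "'a \<Rightarrow> 'a \<Rightarrow> bool" where
  "adj u v \<longleftrightarrow> (\<exists>w. T u v w)"

lemma T_swap12: "T u v w \<longleftrightarrow> T v u w"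
  by (simp add: T_def insert_commute)

lemma T_swap23: "T u v w \<longleftrightarrow> T u w v"
  by (simp add: T_def insert_commute)

lemmas T_perm = T_swap12 T_swap23

lemma T_distinct:
  assumes "T u v w"
  shows "u \<noteq> v" "u \<noteq> w" "v \<noteq> w"
proof -
  have "card {u, v, w} = 3" using linear assms unfolding T_def linear_3_graph_def by blast
  then show "u \<noteq> v" "u \<noteq> w" "v \<noteq> w" by (auto simp: card_insert_if split: if_splits)
qed

lemma edge_eq:
  assumes "e \<in> E" "f \<in> E" "u \<noteq> v" "u \<in> e" "v \<in> e" "u \<in> f" "v \<in> f"
  shows "e = f"
proof (rule ccontr)
  assume "e \<noteq> f"
  then have "card (e \<inter> f) \<le> 1" and "e \<subseteq> V" and "finite V"
    using linear assms unfolding linear_3_graph_def by auto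
  moreover from this have "finite (e \<inter> f)" by (auto dest: finite_subset)
  ultimately show False
    using assms card_le_Suc0_iff_eq[of "e \<inter> f"] by auto
qed

lemma T_unique: "T u v w \<Longrightarrow> T u v w' \<Longrightarrow> w = w'"
  using edge_eq[of "{u, v, w}" "{u, v, w'}" u v] T_distinct(1)[of u v w] T_distinct[of u v w'] T_distinct[of u v w]
  unfolding T_def by auto

lemma edge_through:
  assumes "e \<in> E" "v \<in> e"
  obtains s t where "e = {v, s, t}" "T v s t"
proof -
  have "card e = 3" using linear assms unfolding linear_3_graph_def by auto
  then obtain a b c where "e = {a, b, c}" by (auto simp: card_3_iff)
  then have "e = {v, a, b} \<or> e = {v, b, c} \<or> e = {v, a, c}" using assms by auto
  then show thesis using that assms(1) unfolding T_def by auto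
qed

section \<open>Consequences of the degree bound and of crown-freeness\<close>

text \<open>By linearity each of \<open>a\<close>, \<open>b\<close>, \<open>c\<close> lies on at
  most one edge through \<open>v\<close>, so together they spoil at most three of the four or more
  edges there.\<close>

lemma edge_avoiding:
  assumes "T v x y" "v \<noteq> a" "v \<noteq> b" "v \<noteq> c"
  obtains s t where "T v s t" "s \<noteq> a" "s \<noteq> b" "s \<noteq> c" "t \<noteq> a" "t \<noteq> b" "t \<noteq> c"
proof -
  let ?S = "{e \<in> E. v \<in> e}"
  \<comment> \<open>If no edge joins \<open>v\<close> to \<open>w\<close>, the value is unspecified;
    this is harmless, since only the size of the image is bounded.\<close>
  let ?f = "\<lambda>w. THE e. e \<in> ?S \<and> w \<in> e"
  have "v \<in> V" using assms linear unfolding T_def linear_3_graph_def by auto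
  then have "4 \<le> card ?S" using min_deg unfolding degree_def by auto
  moreover have "card (?f ` {a, b, c}) \<le> 3"
    using card_image_le[of "{a, b, c}" ?f] card_insert_le_m1[of 3 "{b, c}" a]
      card_insert_le_m1[of 2 "{c}" b] by simp
  ultimately have "\<not> ?S \<subseteq> ?f ` {a, b, c}"
    using card_mono[of "?f ` {a, b, c}" ?S] by auto
  then obtain e where e: "e \<in> ?S" "e \<notin> ?f ` {a, b, c}" by auto
  have "w \<notin> e" if "w \<in> {a, b, c}" for w
  proof
    assume "w \<in> e"
    have "?f w = e"
      using e \<open>w \<in> e\<close> that assms(2-4) edge_eq[of _ e v w] by (intro the_equality) auto
    then show False using e that by auto
  qed
  moreover obtain s t where "e = {v, s, t}" "T v s t"
    using e(1) edge_through[of e v] by blast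
  ultimately show thesis using that by auto
qed

lemma no_crown_T:
  assumes "T u v w" "T u u1 u2" "T v v1 v2" "T w w1 w2"
    and "{u, u1, u2} \<inter> {v, v1, v2} = {}"
    and "{u, u1, u2} \<inter> {w, w1, w2} = {}"
    and "{v, v1, v2} \<inter> {w, w1, w2} = {}"
  shows False
proof -
  let ?C = "{{u, u1, u2}, {v, v1, v2}, {w, w1, w2}, {u, v, w}}"
  have "?C \<subseteq> E" using assms unfolding T_def by auto
  moreover have "crown ?C"
    unfolding crown_def
    by (rule exI[of _ "{u, u1, u2}"], rule exI[of _ "{v, v1, v2}"], rule exI[of _ "{w, w1, w2}"],
        rule exI[of _ "{u, v, w}"], intro conjI)
      (use calculation linear assms in \<open>auto simp: linear_3_graph_def simp del: insert_iff\<close>)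
  ultimately show False using no_crown unfolding contains_crown_def by blast
qed

text \<open>If the second vertex of a jewel lies on the base, linearity makes the jewel equal to the
  base, so its first vertex lies there too. Hence only first vertices are compared with the
  base.\<close>

lemma jewels_meet:
  assumes "T u v w" "T u u1 u2" "T v v1 v2" "T w w1 w2"
  shows "u1 = v \<or> u1 = w \<or> v1 = u \<or> v1 = w \<or> w1 = u \<or> w1 = v \<or>
    u1 = v1 \<or> u1 = v2 \<or> u2 = v1 \<or> u2 = v2 \<or>
    u1 = w1 \<or> u1 = w2 \<or> u2 = w1 \<or> u2 = w2 \<or>
    v1 = w1 \<or> v1 = w2 \<or> v2 = w1 \<or> v2 = w2"
proof (rule ccontr)
  assume neg: "\<not> ?thesis"
  have "u2 \<noteq> v" "u2 \<noteq> w" "v2 \<noteq> u" "v2 \<noteq> w" "w2 \<noteq> u" "w2 \<noteq> v"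
    using neg assms by (metis T_unique T_swap12 T_swap23)+
  then show False
    using neg T_distinct[OF assms(1)] no_crown_T[OF assms] by auto
qed

lemma T_meet: "T u v w \<Longrightarrow> T u s t \<Longrightarrow> (v = s \<longleftrightarrow> w = t) \<and> (v = t \<longleftrightarrow> w = s)"
  using T_unique T_swap23 by metis

section \<open>Common neighbours of the vertices of an edge\<close>

text \<open>Otherwise an edge at \<open>x\<close> off \<open>y\<close>, \<open>u\<close>,
  \<open>v\<close>, then an edge at \<open>y\<close> off \<open>x\<close> and the first edge, and
  finally \<open>zuv\<close> are disjoint jewels on the base \<open>xyz\<close>.\<close>

lemma adj_of_edge:
  assumes "T x y z" "T z u v" "u \<noteq> x" "u \<noteq> y"
  shows "adj y u \<or> adj y v"
proof (rule ccontr)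
  assume n: "\<not> ?thesis"
  have rot: "T y x z" "T z x y" using assms by (simp_all add: T_perm)
  have vn: "v \<noteq> x" "v \<noteq> y"
    using assms T_meet[OF rot(2) assms(2)] by auto
  obtain s t where st: "T x s t" "s \<noteq> y" "s \<noteq> u" "s \<noteq> v" "t \<noteq> y" "t \<noteq> u" "t \<noteq> v"
    using edge_avoiding[OF assms(1), of y u v] assms vn T_distinct[OF assms(1)] by auto
  have "s \<noteq> z" "t \<noteq> z" using st T_meet[OF assms(1) st(1)] by auto
  obtain k l where kl: "T y k l" "k \<noteq> x" "k \<noteq> s" "k \<noteq> t" "l \<noteq> x" "l \<noteq> s" "l \<noteq> t"
    using edge_avoiding[OF rot(1), of x s t] st T_distinct[OF assms(1)] by metis
  have "k \<noteq> z" "l \<noteq> z" using kl T_meet[OF rot(1) kl(1)] by auto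
  moreover have "k \<noteq> u" "k \<noteq> v" "l \<noteq> u" "l \<noteq> v" using n kl T_swap23 unfolding adj_def by blast+
  ultimately show False
    using jewels_meet[OF assms(1) st(1) kl(1) assms(2)] st kl assms \<open>s \<noteq> z\<close> by metis
qed

text \<open>Without one, some edge \<open>ypq\<close> has \<open>p\<close> not adjacent to
  \<open>x\<close>. For an edge \<open>zuv\<close> off \<open>x\<close>, \<open>p\<close>,
  \<open>q\<close>, every edge at \<open>x\<close> off \<open>y\<close> and \<open>q\<close> must
  meet \<open>zuv\<close>. This makes \<open>x\<close> adjacent to both \<open>u\<close> and
  \<open>v\<close>, and \<open>adj_of_edge\<close> makes one of them a common neighbour.\<close>

lemma common_neighbour:
  assumes "T x y z"
  obtains (common) p where "p \<noteq> x" "p \<noteq> y" "p \<noteq> z" "adj x p" "adj y p" "adj z p"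
proof (rule ccontr)
  assume "\<not> thesis"
  then have n: "p = x \<or> p = y \<or> p = z" if "adj x p" "adj y p" "adj z p" for p
    using that common by blast
  have rot: "T y x z" "T z x y" "T x z y" "T z y x" "T y z x" using assms by (simp_all add: T_perm)
  note d = T_distinct[OF assms]
  obtain p q where pq: "T y p q" "p \<noteq> x" "p \<noteq> z" "q \<noteq> x" "q \<noteq> z"
    using edge_avoiding[OF rot(1), of x z z] d by metis
  have "T y q p" using pq(1) by (simp add: T_perm)
  then have "adj y p" "adj y q" using pq(1) unfolding adj_def by blast+
  \<comment> \<open>By \<open>adj_of_edge\<close>, \<open>z\<close> is adjacent to \<open>p\<close>
    or \<open>q\<close>; were \<open>x\<close> adjacent to both, that vertex would be a common
    neighbour.\<close>
  then have "\<not> adj x p \<or> \<not> adj x q"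
    using adj_of_edge[OF rot(3) pq(1)] pq n T_distinct[OF pq(1)] by metis
  then obtain p q where pq: "T y p q" "p \<noteq> x" "p \<noteq> z" "q \<noteq> x" "q \<noteq> z" "\<not> adj x p"
    using pq \<open>T y q p\<close> by blast
  obtain u v where uv: "T z u v" "u \<noteq> x" "u \<noteq> p" "u \<noteq> q" "v \<noteq> x" "v \<noteq> p" "v \<noteq> q"
    using edge_avoiding[OF rot(2), of x p q] d pq by metis
  have uvy: "u \<noteq> y" "v \<noteq> y" using uv T_meet[OF rot(2) uv(1)] by auto
  have hit: "s = u \<or> s = v \<or> t = u \<or> t = v" if "T x s t" "s \<noteq> y" "s \<noteq> q" "t \<noteq> y" "t \<noteq> q" for s t
  proof -
    have "s \<noteq> p" "t \<noteq> p" using that pq(6) T_swap23 unfolding adj_def by blast+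
    moreover have "s \<noteq> z" using that T_meet[OF assms that(1)] by auto
    ultimately show ?thesis
      using jewels_meet[OF assms that(1) pq(1) uv(1)] that pq uv uvy by metis
  qed
  have uv2: "T z v u" using uv(1) by (simp add: T_perm)
  \<comment> \<open>An edge at \<open>x\<close> off \<open>u\<close> must pass through
    \<open>v\<close>; the next choice exchanges \<open>u\<close> and \<open>v\<close>.\<close>
  obtain s t where st: "T x s t" "s \<noteq> y" "s \<noteq> q" "s \<noteq> u" "t \<noteq> y" "t \<noteq> q" "t \<noteq> u"
    using edge_avoiding[OF assms, of y q u] d pq uv by metis
  then have v: "adj x v" using hit[OF st(1)] T_swap23 unfolding adj_def by blast
  obtain s t where st: "T x s t" "s \<noteq> y" "s \<noteq> q" "s \<noteq> v" "t \<noteq> y" "t \<noteq> q" "t \<noteq> v"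
    using edge_avoiding[OF assms, of y q v] d pq uv by metis
  then have u: "adj x u" using hit[OF st(1)] T_swap23 unfolding adj_def by blast
  have "adj z u" "adj z v" using uv uv2 unfolding adj_def by blast+
  then show False 
    using adj_of_edge[OF assms uv(1)] n u v uv uvy T_distinct[OF uv(1)] by metis
qed

section \<open>Pencils over an edge\<close>

text \<open>The apex \<open>p\<close> lies off the edge \<open>xyz\<close>, and \<open>a\<close>,
  \<open>b\<close>, \<open>c\<close> complete the edges joining it to \<open>x\<close>,
  \<open>y\<close>, \<open>z\<close>. These are the seven points of the later Fano plane.\<close>

definition pencil :: "'a \<Rightarrow> 'a \<Rightarrow> 'a \<Rightarrow> 'a \<Rightarrow> 'a \<Rightarrow> 'a \<Rightarrow> 'a \<Rightarrow> bool" where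
  "pencil x y z p a b c \<longleftrightarrow>
     T x y z \<and> T x p a \<and> T y p b \<and> T z p c \<and> distinct [x, y, z, p, a, b, c]"

text \<open>These two transpositions generate all permutations of the pairs
  \<open>x\<close>,\<open>a\<close> and \<open>y\<close>,\<open>b\<close> and
  \<open>z\<close>,\<open>c\<close>.\<close>

lemma pencil_sym:
  assumes "pencil x y z p a b c"
  shows "pencil x z y p a c b" "pencil y x z p b a c"
  using assms unfolding pencil_def by (auto simp: T_perm)

lemma exists_pencil:
  assumes "T x y z"
  obtains p a b c where "pencil x y z p a b c"
proof -
  obtain p where p: "p \<noteq> x" "p \<noteq> y" "p \<noteq> z" "adj x p" "adj y p" "adj z p"
    using common_neighbour[OF assms] .
  then obtain a b c where abc: "T x p a" "T y p b" "T z p c" unfolding adj_def by blast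
  have rot: "T y x z" "T z x y" using assms by (simp_all add: T_perm)
  have prot: "T p x a" "T p y b" "T p z c" using abc by (simp_all add: T_perm)
  note T_distinct[OF assms] T_distinct[OF abc(1)] T_distinct[OF abc(2)] T_distinct[OF abc(3)]
    T_meet[OF assms abc(1)] T_meet[OF rot(1) abc(2)] T_meet[OF rot(2) abc(3)]
    T_meet[OF prot(1,2)] T_meet[OF prot(1,3)] T_meet[OF prot(2,3)]
  then have "distinct [x, y, z, p, a, b, c]" using p by simp
  then show thesis using that assms abc unfolding pencil_def by blast
qed

lemma pencil_apex_edge:
  assumes "pencil x y z p a b c"
  obtains q r where "T p q r" "distinct [x, y, z, p, a, b, c, q, r]"
proof -
  have T: "T p x a" "T p y b" "T p z c" and d: "distinct [x, y, z, p, a, b, c]"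
    using assms unfolding pencil_def by (auto simp: T_perm)
  obtain q r where qr: "T p q r" "q \<noteq> x" "q \<noteq> y" "q \<noteq> z" "r \<noteq> x" "r \<noteq> y" "r \<noteq> z"
    using edge_avoiding[OF T(1), of x y z] d by auto
  have "distinct [x, y, z, p, a, b, c, q, r]"
    using d qr T_distinct[OF qr(1)] T_meet[OF T(1) qr(1)] T_meet[OF T(2) qr(1)] T_meet[OF T(3) qr(1)]
    by auto
  then show thesis using that qr by blast
qed

section \<open>Adjacency across a pencil\<close>

text \<open>Testing the base \<open>xpa\<close> against edges at its vertices forces an edge
  \<open>xvb\<close>; testing the base \<open>xyz\<close> then forces \<open>zvb\<close>, against
  linearity.\<close>

lemma nonadj_apex_false_if_xcq:
  assumes P: "pencil x y z p a b c" and pqr: "T p q r" and d: "distinct [x, y, z, p, a, b, c, q, r]"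
    and A: "T a y v" "T a q g" "T a r h" "v \<noteq> q" "v \<noteq> r" "g \<noteq> y" "g \<noteq> r" "h \<noteq> y" "h \<noteq> q"
    and na: "\<not> adj a z" and "v \<noteq> c" and xcq: "T x c q"
  shows False
proof -
  have T: "T x y z" "T x p a" "T y p b" "T z p c" using P unfolding pencil_def by auto
  have T': "T a p x" "T p z c" "T p y b" "T x p a" "T z x y" "T y a v"
    using T A by (simp_all add: T_perm)
  have "v \<noteq> z" "g \<noteq> z" "h \<noteq> z" using na A unfolding adj_def by (metis T_swap23)+
  note ne = this A(4-) \<open>v \<noteq> c\<close> T_distinct[OF A(1)] T_distinct[OF A(2)] T_distinct[OF A(3)]
    T_meet[OF A(1) A(2)] T_meet[OF A(1) A(3)] T_meet[OF A(2) A(3)]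
    T_meet[OF T'(1) A(1)] T_meet[OF T'(1) A(2)] T_meet[OF T'(1) A(3)] T_meet[OF T(2) xcq]
  have vb: "v \<noteq> b" using T_meet[OF T(3) T'(6)] d by auto
  obtain s1 s2 where s: "T x s1 s2" "s1 \<noteq> p" "s1 \<noteq> y" "s1 \<noteq> c" "s2 \<noteq> p" "s2 \<noteq> y" "s2 \<noteq> c"
    using edge_avoiding[OF T(1), of p y c] d by auto
  \<comment> \<open>On the base \<open>xpa\<close>, the jewels \<open>ayv\<close>,
    \<open>pzc\<close> and this edge at \<open>x\<close> can only meet in \<open>v\<close>.\<close>
  have "s1 = v \<or> s2 = v"
    using jewels_meet[OF T'(1) A(1) T'(2) s(1)] s d ne T_meet[OF T'(4) s(1)] T_meet[OF T(1) s(1)] by auto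
  then obtain s where s: "T x v s" "s \<noteq> p" "s \<noteq> y" "s \<noteq> c" using s T_swap23 by blast
  note ns = s T_distinct[OF s(1)] T_meet[OF T'(4) s(1)] T_meet[OF T(1) s(1)] T_meet[OF xcq s(1)]
  have qa: "T q a g" "T q x c" using A xcq by (simp_all add: T_perm)
  have gc: "g \<noteq> c" using T_meet[OF qa(1,2)] d by auto
  have "s = g"
    using jewels_meet[OF T'(1) A(2) T'(2) s(1)] ns d ne gc by auto
  moreover have "h = c"
    using jewels_meet[OF T'(1) A(3) T'(2) s(1)] ns d ne gc \<open>s = g\<close> by auto
  moreover have "g = b"
    using jewels_meet[OF T'(1) A(3) T'(3) s(1)] ns d ne gc vb calculation by auto
  ultimately have xvb: "T x v b" using s by simp
  obtain k l where Z: "T z k l" "k \<noteq> x" "k \<noteq> p" "k \<noteq> q" "l \<noteq> x" "l \<noteq> p" "l \<noteq> q"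
    using edge_avoiding[OF T'(5), of x p q] d by auto
  \<comment> \<open>Nonadjacency of \<open>a\<close> and \<open>z\<close> keeps this edge off
    \<open>a\<close>, leaving \<open>b\<close> and \<open>v\<close> as the only possible meeting
    points in the next two tests.\<close>
  have "k \<noteq> a" "l \<noteq> a" using Z na T_swap12 T_swap23 unfolding adj_def by metis+
  note nz = this Z T_distinct[OF Z(1)] T_meet[OF T'(5) Z(1)] T_meet[OF T(4) Z(1)]
  have "k = b \<or> l = b" using jewels_meet[OF T(1) xcq T(3) Z(1)] nz d by auto
  moreover have "k = v \<or> l = v" using jewels_meet[OF T(1) xcq T'(6) Z(1)] nz d ne by auto
  ultimately have "T z v b" using Z vb T_swap23 by metis
  then show False using xvb d T_unique[of v b x z] by (simp add: T_perm)
qed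

text \<open>On the base \<open>xpa\<close>, an edge at \<open>x\<close> off \<open>p\<close>,
  \<open>y\<close>, \<open>v\<close> must contain \<open>c\<close> and one of \<open>q\<close>,
  \<open>r\<close>. Both cases are the preceding configuration, up to exchanging \<open>q\<close>
  and \<open>r\<close>.\<close>

lemma nonadj_apex_yav_eq:
  assumes P: "pencil x y z p a b c" and pqr: "T p q r" and d: "distinct [x, y, z, p, a, b, c, q, r]"
    and A: "T a y v" "T a q g" "T a r h" "v \<noteq> q" "v \<noteq> r" "g \<noteq> y" "g \<noteq> r" "h \<noteq> y" "h \<noteq> q"
    and na: "\<not> adj a z" and "v \<noteq> c"
  shows False
proof -
  have T: "T x y z" "T x p a" "T y p b" "T z p c" using P unfolding pencil_def by auto
  have T': "T a p x" "T p z c" "T p r q" using T pqr by (simp_all add: T_perm)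
  have "v \<noteq> z" using na A unfolding adj_def by (metis T_swap23)
  note ne = this A(4-) \<open>v \<noteq> c\<close> T_distinct[OF A(1)] T_meet[OF T'(1) A(1)]
  obtain s1 s2 where s: "T x s1 s2" "s1 \<noteq> p" "s1 \<noteq> y" "s1 \<noteq> v" "s2 \<noteq> p" "s2 \<noteq> y" "s2 \<noteq> v"
    using edge_avoiding[OF T(1), of p y v] d ne by auto
  note ns = s T_meet[OF T(2) s(1)] T_meet[OF T(1) s(1)]
  have "s1 = c \<or> s2 = c"
    using jewels_meet[OF T'(1) A(1) T'(2) s(1)] ns d ne by auto
  moreover have "s1 = q \<or> s2 = q \<or> s1 = r \<or> s2 = r"
    using jewels_meet[OF T'(1) A(1) pqr s(1)] ns d ne by auto
  ultimately have "T x c q \<or> T x c r"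
    using s(1) d T_swap23[of x s1 s2] by auto
  then show False
    using nonadj_apex_false_if_xcq[OF P pqr d A na \<open>v \<noteq> c\<close>]
      nonadj_apex_false_if_xcq[OF P T'(3) _ A(1,3,2,5,4,8,9,6,7) na \<open>v \<noteq> c\<close>] d by auto
qed

text \<open>The base \<open>xpa\<close> forces this edge to be \<open>xrg\<close>, and the base
  \<open>zpc\<close> then yields an edge \<open>zqm\<close>. Now \<open>xrg\<close>,
  \<open>yac\<close>, \<open>zqm\<close> are disjoint jewels on \<open>xyz\<close>.\<close>

lemma nonadj_apex_no_x_edge_avoiding:
  assumes P: "pencil x y z p a b c" and pqr: "T p q r" and d: "distinct [x, y, z, p, a, b, c, q, r]"
    and A: "T a y c" "T a q g" "T a r h" "g \<noteq> y" "g \<noteq> r" "h \<noteq> y" "h \<noteq> q"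
    and na: "\<not> adj a z"
    and X: "T x s t" "s \<noteq> p" "s \<noteq> y" "s \<noteq> c" "t \<noteq> p" "t \<noteq> y" "t \<noteq> c" and "s \<noteq> q" "t \<noteq> q"
  shows False
proof -
  have T: "T x y z" "T x p a" "T y p b" "T z p c" using P unfolding pencil_def by auto
  have T': "T a p x" "T p z c" "T z p c" "T c a y" "T z x y" "T y a c"
    using T A by (simp_all add: T_perm)
  have "g \<noteq> z" using na A unfolding adj_def by (metis T_swap23)
  note ne = this A(4-) T_distinct[OF A(2)] T_distinct[OF A(3)]
    T_meet[OF A(1) A(2)] T_meet[OF A(1) A(3)] T_meet[OF A(2) A(3)]
    T_meet[OF T'(1) A(1)] T_meet[OF T'(1) A(2)] T_meet[OF T'(1) A(3)]
  note nx = X T_distinct[OF X(1)] T_meet[OF T(2) X(1)] T_meet[OF T(1) X(1)] \<open>s \<noteq> q\<close> \<open>t \<noteq> q\<close>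
  have "s = r \<or> t = r"
    using jewels_meet[OF T'(1) A(1) pqr X(1)] nx ne d by auto
  moreover have "s = g \<or> t = g"
    using jewels_meet[OF T'(1) A(2) T'(2) X(1)] nx ne d by auto
  ultimately have xrg: "T x r g" using X(1) ne T_swap23 by metis
  obtain k l where Z: "T z k l" "k \<noteq> x" "k \<noteq> p" "k \<noteq> r" "l \<noteq> x" "l \<noteq> p" "l \<noteq> r"
    using edge_avoiding[OF T'(5), of x p r] d by auto
  have "k \<noteq> a" "l \<noteq> a" using Z na T_swap12 T_swap23 unfolding adj_def by metis+
  note nz = this Z T_distinct[OF Z(1)] T_meet[OF T'(5) Z(1)] T_meet[OF T(4) Z(1)]
  have "k = q \<or> l = q"
    using jewels_meet[OF T'(3) Z(1) pqr T'(4)] nz d by auto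
  then obtain m where m: "T z q m" "m \<noteq> x" "m \<noteq> p" "m \<noteq> r" "m \<noteq> a"
    using Z \<open>k \<noteq> a\<close> \<open>l \<noteq> a\<close> T_swap23 by metis
  have "T q z m" "T q a g" using m A by (simp_all add: T_perm)
  then have "m \<noteq> g" using T_meet[of q z m a g] d by auto
  then show False
    using jewels_meet[OF T(1) xrg T'(6) m(1)] m ne d T_distinct[OF m(1)] T_distinct[OF xrg]
      T_meet[OF T(1) xrg] T_meet[OF T(2) xrg] T_meet[OF T'(5) m(1)] T_meet[OF T(4) m(1)] by auto
qed

text \<open>If \<open>a\<close> and \<open>z\<close> are not adjacent, the base \<open>xpa\<close>
  with jewels \<open>xyz\<close> and \<open>pqr\<close> forces every other edge at \<open>a\<close>
  through \<open>y\<close>, \<open>q\<close> or \<open>r\<close>. The preceding lemmas then force an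
  edge \<open>xqr\<close>, which shares two vertices with \<open>pqr\<close>.\<close>

lemma pencil_adj:
  assumes P: "pencil x y z p a b c"
  shows "adj a z"
proof (rule ccontr)
  assume na: "\<not> adj a z"
  have T: "T x y z" "T x p a" "T y p b" "T z p c" using P unfolding pencil_def by auto
  obtain q r where pqr: "T p q r" and d: "distinct [x, y, z, p, a, b, c, q, r]"
    using pencil_apex_edge[OF P] .
  have T': "T a x p" "T p r q" using T pqr by (simp_all add: T_perm)
  have hit: "k \<in> {y, q, r} \<or> l \<in> {y, q, r}" if "T a k l" "k \<noteq> x" "l \<noteq> x" for k l
  proof -
    have "k \<noteq> z" "l \<noteq> z" using that na T_swap23 unfolding adj_def by metis+
    then show ?thesis
      using jewels_meet[OF T(2) T(1) pqr that(1)] that d T_distinct[OF that(1)] T_meet[OF T'(1) that(1)] by auto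
  qed
  \<comment> \<open>An edge at \<open>a\<close> off \<open>x\<close>, \<open>q\<close>,
    \<open>r\<close> must pass through \<open>y\<close>; the two further choices single out
    \<open>q\<close> and \<open>r\<close>.\<close>
  obtain k l where kl: "T a k l" "k \<noteq> x" "k \<noteq> q" "k \<noteq> r" "l \<noteq> x" "l \<noteq> q" "l \<noteq> r"
    using edge_avoiding[OF T'(1), of x q r] d by auto
  then obtain v where v: "T a y v" "v \<noteq> q" "v \<noteq> r"
    using hit[OF kl(1)] T_swap23[of a k l] by auto
  obtain k l where kl: "T a k l" "k \<noteq> x" "k \<noteq> y" "k \<noteq> r" "l \<noteq> x" "l \<noteq> y" "l \<noteq> r"
    using edge_avoiding[OF T'(1), of x y r] d by auto
  then obtain g where g: "T a q g" "g \<noteq> y" "g \<noteq> r"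
    using hit[OF kl(1)] T_swap23[of a k l] by auto
  obtain k l where kl: "T a k l" "k \<noteq> x" "k \<noteq> y" "k \<noteq> q" "l \<noteq> x" "l \<noteq> y" "l \<noteq> q"
    using edge_avoiding[OF T'(1), of x y q] d by auto
  then obtain h where h: "T a r h" "h \<noteq> y" "h \<noteq> q"
    using hit[OF kl(1)] T_swap23[of a k l] by auto
  have "v = c"
    using nonadj_apex_yav_eq[OF P pqr d v(1) g(1) h(1)] v g h na by auto
  then have ayc: "T a y c" using v by simp
  note aux = nonadj_apex_no_x_edge_avoiding[OF P pqr d ayc g(1) h(1) g(2,3) h(2,3) na]
    nonadj_apex_no_x_edge_avoiding[OF P T'(2) _ ayc h(1) g(1) h(2,3) g(2,3) na]
  obtain s t where st: "T x s t" "s \<noteq> p" "s \<noteq> y" "s \<noteq> c" "t \<noteq> p" "t \<noteq> y" "t \<noteq> c"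
    using edge_avoiding[OF T(1), of p y c] d by auto
  have "s = q \<or> t = q" using aux(1)[OF st] by blast
  moreover have "s = r \<or> t = r" using aux(2)[OF _ st] d by auto
  ultimately have "T x q r" using st(1) d T_swap23[of x s t] by auto
  then show False using pqr d T_unique[of q r x p] by (simp add: T_perm)
qed

section \<open>Completion of a pencil to a Fano plane\<close>

text \<open>The base \<open>xpa\<close> with jewels \<open>xyz\<close> and \<open>pqr\<close> forces
  an edge at \<open>a\<close> off \<open>x\<close>, \<open>y\<close>, \<open>z\<close> through
  \<open>q\<close> or \<open>r\<close>; these two names may be exchanged.\<close>

lemma pencil_extra_edge:
  assumes P: "pencil x y z p a b c"
  obtains q r g where "T p q r" "T a q g" "g \<noteq> y" "g \<noteq> z" "g \<noteq> r" "distinct [x, y, z, p, a, b, c, q, r]"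
proof -
  have T: "T x y z" "T x p a" using P unfolding pencil_def by auto
  obtain q r where pqr: "T p q r" and d: "distinct [x, y, z, p, a, b, c, q, r]"
    using pencil_apex_edge[OF P] .
  have T': "T a x p" "T p r q" using T pqr by (simp_all add: T_perm)
  obtain k l where kl: "T a k l" "k \<noteq> x" "k \<noteq> y" "k \<noteq> z" "l \<noteq> x" "l \<noteq> y" "l \<noteq> z"
    using edge_avoiding[OF T'(1), of x y z] d by auto
  have "\<not> T a q r" using T_unique[of q r a p] pqr d by (auto simp: T_perm)
  moreover have "k = q \<or> k = r \<or> l = q \<or> l = r"
    using jewels_meet[OF T(2) T(1) pqr kl(1)] kl d T_distinct[OF kl(1)] T_meet[OF T'(1) kl(1)] by auto
  moreover have "T a l k" using kl by (simp add: T_perm)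
  ultimately consider (q) g where "T a q g" "g \<noteq> y" "g \<noteq> z" "g \<noteq> r"
    | (r) g where "T a r g" "g \<noteq> y" "g \<noteq> z" "g \<noteq> q"
    using kl T_swap23[of a q r] by metis
  then show thesis
  proof cases
    case q then show thesis using that pqr d by blast
  next
    case r
    have "distinct [x, y, z, p, a, b, c, r, q]" using d by auto
    then show thesis using that T'(2) r by blast
  qed
qed

text \<open>Otherwise the base \<open>xpa\<close> forces edges \<open>xcs\<close> and
  \<open>xmt\<close> in which \<open>s\<close>, \<open>t\<close> are \<open>n\<close>,
  \<open>b\<close> in some order; both orders are impossible.\<close>

lemma pencil_fano_line:
  assumes P: "pencil x y z p a b c" and A: "T a y m" "T a z n"
  shows "m = c \<or> n = b"
proof (rule ccontr)
  assume "\<not> ?thesis"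
  then have mc: "m \<noteq> c" and nb: "n \<noteq> b" by auto
  have T: "T x y z" "T x p a" "T y p b" "T z p c" using P unfolding pencil_def by auto
  obtain q r g where pqr: "T p q r" and aqg: "T a q g" "g \<noteq> y" "g \<noteq> z"
    and d: "distinct [x, y, z, p, a, b, c, q, r]"
    using pencil_extra_edge[OF P] .
  have T': "T a p x" "T p z c" "T p y b" "T z x y" "T y a m" "T z a n" "T m a y" "T n a z"
    "T y x z"
    using T A by (simp_all add: T_perm)
  have mn: "m \<noteq> n" using T_meet[of m a y a z] T' d by auto
  note ne = mn mc nb aqg T_distinct[OF A(1)] T_distinct[OF A(2)] T_distinct[OF aqg(1)]
    T_meet[OF A] T_meet[OF A(1) aqg(1)] T_meet[OF A(2) aqg(1)]
    T_meet[OF T'(1) A(1)] T_meet[OF T'(1) A(2)] T_meet[OF T'(1) aqg(1)]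
    T_meet[OF T(3) T'(5)] T_meet[OF T(4) T'(6)] T_meet[OF T'(9) T'(5)]
  have X: "s = m \<or> s = c \<or> t = m \<or> t = c" "s = n \<or> s = b \<or> t = n \<or> t = b"
    "g = c \<or> s = q \<or> s = g \<or> s = c \<or> t = q \<or> t = g \<or> t = c"
    "g = b \<or> s = q \<or> s = g \<or> s = b \<or> t = q \<or> t = g \<or> t = b"
    if "T x s t" "s \<noteq> p" "s \<noteq> y" "t \<noteq> p" "t \<noteq> y" for s t
  proof -
    note ns = that T_distinct[OF that(1)] T_meet[OF T(2) that(1)] T_meet[OF T(1) that(1)]
    show "s = m \<or> s = c \<or> t = m \<or> t = c"
      using jewels_meet[OF T'(1) A(1) T'(2) that(1)] ns ne d by auto
    show "s = n \<or> s = b \<or> t = n \<or> t = b"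
      using jewels_meet[OF T'(1) A(2) T'(3) that(1)] ns ne d by auto
    show "g = c \<or> s = q \<or> s = g \<or> s = c \<or> t = q \<or> t = g \<or> t = c"
      using jewels_meet[OF T'(1) aqg(1) T'(2) that(1)] ns ne d by auto
    show "g = b \<or> s = q \<or> s = g \<or> s = b \<or> t = q \<or> t = g \<or> t = b"
      using jewels_meet[OF T'(1) aqg(1) T'(3) that(1)] ns ne d by auto
  qed
  obtain s1 s2 where "T x s1 s2" "s1 \<noteq> p" "s1 \<noteq> y" "s1 \<noteq> m" "s2 \<noteq> p" "s2 \<noteq> y" "s2 \<noteq> m"
    using edge_avoiding[OF T(1), of p y m] d ne by auto
  then obtain s where s: "T x c s" "s \<noteq> p" "s \<noteq> y" "s \<noteq> m"
    using X(1)[of s1 s2] T_swap23[of x s1 s2] by auto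
  obtain t1 t2 where "T x t1 t2" "t1 \<noteq> p" "t1 \<noteq> y" "t1 \<noteq> c" "t2 \<noteq> p" "t2 \<noteq> y" "t2 \<noteq> c"
    using edge_avoiding[OF T(1), of p y c] d by auto
  then obtain t where t: "T x m t" "t \<noteq> p" "t \<noteq> y" "t \<noteq> c"
    using X(1)[of t1 t2] T_swap23[of x t1 t2] by auto
  have "s = n \<or> s = b" using X(2)[OF s(1)] s d ne by auto
  moreover have "t = n \<or> t = b" using X(2)[OF t(1)] t d ne by auto
  moreover have "s \<noteq> t" using T_meet[OF s(1) t(1)] mc by auto
  ultimately consider "s = b" "t = n" | "s = n" "t = b" by blast
  then show False
  proof cases
    case 1
    \<comment> \<open>The edge \<open>xmn\<close> would force \<open>g\<close> to equal both
      \<open>c\<close> and \<open>b\<close>.\<close>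
    then show False using X(3)[OF t(1)] X(4)[OF t(1)] t ne d by auto
  next
    case 2
    then have xcn: "T x c n" and xmb: "T x m b" using s t by auto
    \<comment> \<open>On the base \<open>xyz\<close>, this edge is forced to be \<open>zmb\<close>,
      which shares \<open>m\<close> and \<open>b\<close> with \<open>xmb\<close>.\<close>
    obtain k l where Z: "T z k l" "k \<noteq> x" "k \<noteq> p" "k \<noteq> a" "l \<noteq> x" "l \<noteq> p" "l \<noteq> a"
      using edge_avoiding[OF T'(4), of x p a] d by auto
    note nz = Z T_distinct[OF Z(1)] T_meet[OF T'(4) Z(1)] T_meet[OF T(4) Z(1)] T_meet[OF T'(6) Z(1)]
    have "k = b \<or> l = b" using jewels_meet[OF T(1) xcn T(3) Z(1)] nz ne d by auto
    moreover have "k = m \<or> l = m" using jewels_meet[OF T(1) xcn T'(5) Z(1)] nz ne d by auto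
    ultimately have "T z m b" using Z ne d T_swap23[of z k l] by auto
    then show False using xmb d T_unique[of m b x z] by (simp add: T_perm)
  qed
qed

text \<open>By \<open>pencil_adj\<close>, \<open>x\<close> is adjacent to \<open>b\<close> and
  \<open>c\<close>. If this gave two edges \<open>xbs\<close> and \<open>xct\<close>, the base
  \<open>xpa\<close> would force both \<open>s\<close> and \<open>t\<close> to be
  \<open>q\<close>.\<close>

lemma pencil_fano_third_line:
  assumes P: "pencil x y z p a b c" and A: "T y a c" "T z a b"
  shows "T x b c"
proof (rule ccontr)
  assume n: "\<not> T x b c"
  have T: "T x y z" "T x p a" "T y p b" "T z p c" using P unfolding pencil_def by auto
  obtain q r g where pqr: "T p q r" and aqg: "T a q g" "g \<noteq> y" "g \<noteq> z" "g \<noteq> r"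
    and d: "distinct [x, y, z, p, a, b, c, q, r]"
    using pencil_extra_edge[OF P] .
  have P': "pencil y x z p b a c" "pencil z x y p c a b" using pencil_sym P by blast+
  have "adj x b" "adj x c"
    using pencil_adj[OF pencil_sym(1)[OF P'(1)]] pencil_adj[OF pencil_sym(1)[OF P'(2)]]
    unfolding adj_def by (metis T_swap12)+
  then obtain s t where st: "T x b s" "T x c t" unfolding adj_def by blast
  have T': "T a p x" "T p z c" "T p y b" "T a y c" "T a z b"
    using T A by (simp_all add: T_perm)
  have "s \<noteq> c" "t \<noteq> b" using n st T_swap23 by auto
  note ne = this d aqg T_distinct[OF aqg(1)]
    T_meet[OF T'(4) aqg(1)] T_meet[OF T'(5) aqg(1)] T_meet[OF T'(1) aqg(1)]
    T_distinct[OF st(1)] T_distinct[OF st(2)]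
    T_meet[OF T(2) st(1)] T_meet[OF T(1) st(1)] T_meet[OF T(2) st(2)] T_meet[OF T(1) st(2)]
  have "s = q \<or> s = r" using jewels_meet[OF T'(1) T'(4) pqr st(1)] ne by auto
  moreover have "s = q \<or> s = g" using jewels_meet[OF T'(1) aqg(1) T'(2) st(1)] ne by auto
  moreover have "t = q \<or> t = r" using jewels_meet[OF T'(1) T'(5) pqr st(2)] ne by auto
  moreover have "t = q \<or> t = g" using jewels_meet[OF T'(1) aqg(1) T'(3) st(2)] ne by auto
  ultimately show False using T_meet[OF st] ne by auto
qed

text \<open>Of any two of the three lines one exists by \<open>pencil_fano_line\<close>, so at most
  one is missing, and \<open>pencil_fano_third_line\<close> supplies it.\<close>

lemma pencil_fano:
  assumes P: "pencil x y z p a b c"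
  shows "T y a c" "T z a b" "T x b c"
proof -
  have sym: "pencil x z y p a c b" "pencil y x z p b a c" "pencil y z x p b c a"
    "pencil z x y p c a b" "pencil z y x p c b a"
    using P pencil_sym by blast+
  have "adj a y" "adj a z" "adj b x" "adj b z" "adj c x" "adj c y"
    using pencil_adj P sym by blast+
  then obtain a1 a2 b1 b2 c1 c2 where
    "T a y a1" "T a z a2" "T b x b1" "T b z b2" "T c x c1" "T c y c2"
    unfolding adj_def by blast
  then have "T a y c \<or> T a z b" "T b x c \<or> T b z a" "T c x b \<or> T c y a"
    using pencil_fano_line[OF P] pencil_fano_line[OF sym(2)] pencil_fano_line[OF sym(4)] by metis+
  moreover have "T y a c \<Longrightarrow> T z a b \<Longrightarrow> T x b c" "T x b c \<Longrightarrow> T z a b \<Longrightarrow> T y a c"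
    "T x b c \<Longrightarrow> T y a c \<Longrightarrow> T z a b"
    using pencil_fano_third_line[OF P] pencil_fano_third_line[OF sym(2)]
      pencil_fano_third_line[OF sym(4)] by (simp_all add: T_perm)
  moreover have "T a y c = T y a c" "T a z b = T z a b" "T b x c = T x b c"
    "T b z a = T z a b" "T c x b = T x b c" "T c y a = T y a c"
    by (simp_all add: T_perm)
  ultimately show "T y a c" "T z a b" "T x b c" by metis+
qed

section \<open>Excluding a Fano plane\<close>

lemma no_fano:
  assumes F: "card F = 7"
    and line: "\<And>u v. u \<in> F \<Longrightarrow> v \<in> F \<Longrightarrow> u \<noteq> v \<Longrightarrow> \<exists>w\<in>F. T u v w"
  shows False
proof -
  have pick: "\<exists>v\<in>F. v \<notin> set xs" if "length xs < 7" for xs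
    using card_mono[of "set xs" F] card_length[of xs] that F by force
  \<comment> \<open>Three lines through \<open>u\<close> exhaust the seven points;
    \<open>v1\<close>, \<open>v2\<close>, \<open>v3\<close> are one point from each, so an edge at
    \<open>u\<close> avoiding them leaves the plane.\<close>
  have cover: "\<exists>v1\<in>F. \<exists>v2\<in>F. \<exists>v3\<in>F. v1 \<noteq> u \<and> v2 \<noteq> u \<and> v3 \<noteq> u \<and>
    (\<forall>k\<in>F - {u}. k \<in> {v1, v2, v3} \<or> T u k v1 \<or> T u k v2 \<or> T u k v3)" if u: "u \<in> F" for u
  proof -
    obtain v1 where v1: "v1 \<in> F" "v1 \<noteq> u" using pick[of "[u]"] by auto
    obtain w1 where w1: "w1 \<in> F" "T u v1 w1" using line[OF u v1(1)] v1 by auto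
    obtain v2 where v2: "v2 \<in> F" "v2 \<noteq> u" "v2 \<noteq> v1" "v2 \<noteq> w1"
      using pick[of "[u, v1, w1]"] by auto
    obtain w2 where w2: "w2 \<in> F" "T u v2 w2" using line[OF u v2(1)] v2 by auto
    obtain v3 where v3: "v3 \<in> F" "v3 \<noteq> u" "v3 \<noteq> v1" "v3 \<noteq> w1" "v3 \<noteq> v2" "v3 \<noteq> w2"
      using pick[of "[u, v1, w1, v2, w2]"] by auto
    obtain w3 where w3: "w3 \<in> F" "T u v3 w3" using line[OF u v3(1)] v3 by auto
    have "distinct [u, v1, w1, v2, w2, v3, w3]"
      using v2 v3 T_distinct[OF w1(2)] T_distinct[OF w2(2)] T_distinct[OF w3(2)]
        T_meet[OF w1(2) w2(2)] T_meet[OF w1(2) w3(2)] T_meet[OF w2(2) w3(2)] by auto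
    then have "card (set [u, v1, w1, v2, w2, v3, w3]) = 7" by (simp only: distinct_card) simp
    moreover have "set [u, v1, w1, v2, w2, v3, w3] \<subseteq> F" using u v1 v2 v3 w1 w2 w3 by simp
    moreover have "finite F" using F card.infinite by fastforce
    ultimately have "F = set [u, v1, w1, v2, w2, v3, w3]" using F card_subset_eq by metis
    then have "\<forall>k\<in>F - {u}. k \<in> {v1, v2, v3} \<or> T u k v1 \<or> T u k v2 \<or> T u k v3"
      using w1(2) w2(2) w3(2) by (auto simp: T_perm)
    then show ?thesis using v1 v2 v3 by blast
  qed
  have in_F: "w \<in> F" if "T u v w" "u \<in> F" "v \<in> F" for u v w
    using line[OF that(2,3)] T_distinct[OF that(1)] T_unique[OF that(1)] by blast
  have extra: "\<exists>k l. T u k l \<and> k \<notin> F \<and> l \<notin> F" if u: "u \<in> F" for u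
  proof -
    obtain v1 v2 v3 where v: "v1 \<in> F" "v1 \<noteq> u" "v2 \<noteq> u" "v3 \<noteq> u"
      "\<And>k. k \<in> F \<Longrightarrow> k \<noteq> u \<Longrightarrow> k \<in> {v1, v2, v3} \<or> T u k v1 \<or> T u k v2 \<or> T u k v3"
      using cover[OF u] by blast
    obtain w where "T u v1 w" using line[OF u v(1)] v(2) by auto
    then obtain k l where kl: "T u k l" "k \<noteq> v1" "k \<noteq> v2" "k \<noteq> v3" "l \<noteq> v1" "l \<noteq> v2" "l \<noteq> v3"
      using edge_avoiding[of u v1 w v1 v2 v3] v by metis
    have "T u l k" using kl(1) by (simp add: T_perm)
    have "k \<notin> F" using v(5)[of k] kl T_unique[OF kl(1)] T_distinct[OF kl(1)] by blast
    moreover have "l \<notin> F"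
      using v(5)[of l] kl T_unique[OF \<open>T u l k\<close>] T_distinct[OF kl(1)] by blast
    ultimately show ?thesis using kl by blast
  qed
  \<comment> \<open>The base is the line \<open>uvw\<close> of the plane, and the third jewel is
    another line of the plane through \<open>w\<close>.\<close>
  have meet: "u1 = v1 \<or> u1 = v2 \<or> u2 = v1 \<or> u2 = v2"
    if uv: "u \<in> F" "v \<in> F" "u \<noteq> v" and "T u u1 u2" "u1 \<notin> F" "u2 \<notin> F"
      and "T v v1 v2" "v1 \<notin> F" "v2 \<notin> F" for u u1 u2 v v1 v2
  proof -
    obtain w where w: "w \<in> F" "T u v w" using line uv by blast
    obtain k where k: "k \<in> F" "k \<noteq> u" "k \<noteq> v" "k \<noteq> w" using pick[of "[u, v, w]"] by auto
    obtain l where l: "l \<in> F" "T w k l" using line[OF w(1) k(1)] k by auto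
    have "T w u v" using w by (simp add: T_perm)
    then show ?thesis
      using jewels_meet[OF w(2) that(4,7) l(2)] that w k l T_meet[OF \<open>T w u v\<close> l(2)] by metis
  qed
  obtain u where u: "u \<in> F" using pick[of "[]"] by auto
  obtain v where v: "v \<in> F" "v \<noteq> u" using pick[of "[u]"] by auto
  obtain u1 u2 where u12: "T u u1 u2" "u1 \<notin> F" "u2 \<notin> F" using extra u by blast
  obtain v1 v2 where v12: "T v v1 v2" "v1 \<notin> F" "v2 \<notin> F" using extra v by blast
  have "\<exists>q u' v'. T u q u' \<and> T v q v' \<and> q \<notin> F \<and> u' \<notin> F \<and> v' \<notin> F"
    using meet[OF u v(1) _ u12 v12] v u12 v12 T_swap23 by metis
  then obtain q u' v' where uv: "T u q u'" "T v q v'" "q \<notin> F" "u' \<notin> F" "v' \<notin> F" by blast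
  have swap: "T q u u'" "T q v v'" using uv by (simp_all add: T_perm)
  \<comment> \<open>An outward edge at \<open>w\<close> meets both \<open>uqu'\<close> and
    \<open>vqv'\<close>; if it misses \<open>q\<close>, it takes \<open>u'\<close> from one and
    \<open>v'\<close> from the other.\<close>
  have noq: "\<exists>w'. T w q w' \<and> w' \<notin> F \<or> T w u' v'" if w: "w \<in> F" "w \<noteq> u" "w \<noteq> v" for w
  proof -
    obtain k l where kl: "T w k l" "k \<notin> F" "l \<notin> F" using extra w by blast
    then show ?thesis
      using meet[OF u w(1) _ uv(1,3,4) kl] meet[OF v(1) w(1) _ uv(2,3,5) kl] w T_swap23[of w k l]
        T_meet[OF swap] v by metis
  qed
  have star: "\<exists>w'. T w q w' \<and> w' \<notin> F" if w: "w \<in> F" for w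
  proof (rule ccontr)
    assume n: "\<not> ?thesis"
    then have "w \<noteq> u" "w \<noteq> v" using uv by blast+
    then have w': "T w u' v'" using noq w n by blast
    obtain t where t: "t \<in> F" "t \<noteq> u" "t \<noteq> v" "t \<noteq> w" using pick[of "[u, v, w]"] by auto
    \<comment> \<open>Only one point can carry the pair \<open>u'\<close>, \<open>v'\<close>, so
      \<open>t\<close> has an edge through \<open>q\<close>; that edge cannot meet
      \<open>wu'v'\<close>.\<close>
    have "\<not> T t u' v'" using w' t(4) T_unique[of u' v' t w] by (auto simp: T_perm)
    then obtain t' where t': "T t q t'" "t' \<notin> F" using noq[OF t(1-3)] by blast
    have "T q t t'" using t' by (simp add: T_perm)
    have "q \<noteq> u'" "q \<noteq> v'" using uv T_distinct by blast+
    then show False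
      using meet[OF w t(1) _ w' uv(4,5) t'(1) uv(3) t'(2)] t
        T_meet[OF swap(1) \<open>T q t t'\<close>] T_meet[OF swap(2) \<open>T q t t'\<close>] by auto
  qed
  have tip_inj: "s' \<noteq> t'" if "T s q s'" "T t q t'" "s \<noteq> t" for s s' t t'
    using that T_unique[of q s' s t] by (auto simp: T_perm)
  \<comment> \<open>Distinct star edges have distinct outer ends, so among three of them one avoids
    both \<open>k\<close> and \<open>l\<close>.\<close>
  have three: "\<exists>v v'. v \<in> F \<and> v \<notin> set xs \<and> T v q v' \<and> v' \<notin> F \<and> v' \<noteq> k \<and> v' \<noteq> l"
    if len: "length xs \<le> 3" for xs k l
  proof -
    obtain s where s: "s \<in> F" "s \<notin> set xs" using pick[of xs] len by auto
    obtain t where t: "t \<in> F" "t \<notin> set xs" "t \<noteq> s" using pick[of "s # xs"] len by auto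
    obtain w where w: "w \<in> F" "w \<notin> set xs" "w \<noteq> s" "w \<noteq> t"
      using pick[of "s # t # xs"] len by auto
    obtain s' t' w' where "T s q s'" "T t q t'" "T w q w'" "s' \<notin> F" "t' \<notin> F" "w' \<notin> F"
      using star s t w by meson
    then show ?thesis using s t w tip_inj by metis
  qed
  have through_q: "k = q \<or> l = q" if w: "w \<in> F" and kl: "T w k l" "k \<notin> F" "l \<notin> F" for w k l
  proof -
    obtain v v' where v: "v \<in> F" "v \<noteq> w" "T v q v'" "v' \<notin> F" "v' \<noteq> k" "v' \<noteq> l"
      using three[of "[w]" k l] by auto
    then show ?thesis using meet[OF w v(1) _ kl v(3) uv(3) v(4)] by auto
  qed
  obtain u' where u': "T u q u'" "u' \<notin> F" using star u by blast
  have u'_edge: "T u' u q" using u' by (simp add: T_perm)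
  then obtain s t where st: "T u' s t" "s \<noteq> u" "s \<noteq> q" "t \<noteq> u" "t \<noteq> q"
    using edge_avoiding[of u' u q u q q] T_distinct[OF u'(1)] by metis
  \<comment> \<open>A point of \<open>F\<close> on this edge would make it an outward edge of that
    point, hence an edge through \<open>q\<close>.\<close>
  have off: "s \<notin> F" if "T u' s t" "s \<noteq> u" "s \<noteq> q" "t \<noteq> u" "t \<noteq> q" for s t
  proof
    assume "s \<in> F"
    have "T s u' t" "T s t u'" using that by (simp_all add: T_perm)
    then have "t \<notin> F" using in_F \<open>s \<in> F\<close> u' by blast
    then show False
      using through_q[OF \<open>s \<in> F\<close> \<open>T s u' t\<close>] u' that T_distinct[OF u'(1)] by auto
  qed
  have "T u' t s" using st by (simp add: T_perm)
  then have st_off: "s \<notin> F" "t \<notin> F" using off st by blast+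
  obtain x where x: "x \<in> F" "x \<noteq> u" using pick[of "[u]"] by auto
  obtain a where a: "a \<in> F" "T u x a" using line[OF u x(1)] x by auto
  \<comment> \<open>The crown has base \<open>uqu'\<close> and jewels \<open>uxa\<close> inside the
    plane, the star edge \<open>qww'\<close> chosen off \<open>s\<close> and \<open>t\<close>, and
    \<open>u'st\<close>.\<close>
  obtain w w' where w: "w \<in> F" "w \<notin> set [u, x, a]" "T w q w'" "w' \<notin> F" "w' \<noteq> s" "w' \<noteq> t"
    using three[of "[u, x, a]" s t] by auto
  have "T q w w'" using w by (simp add: T_perm)
  have "x \<noteq> q" "x \<noteq> u'" "w \<noteq> u'" "x \<noteq> w'" "a \<noteq> w'" "x \<noteq> s" "x \<noteq> t" "a \<noteq> s" "a \<noteq> t" "w \<noteq> s" "w \<noteq> t"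
    using x a w u' uv(3) st_off by auto
  then show False
    using jewels_meet[OF u'(1) a(2) \<open>T q w w'\<close> st(1)] w(2,5,6) st(2,3) by auto
qed

lemma no_edge: "\<not> T x y z"
proof
  assume "T x y z"
  then obtain p a b c where P: "pencil x y z p a b c" using exists_pencil by blast
  have d: "distinct [x, y, z, p, a, b, c]"
    and L: "T x y z" "T x p a" "T y p b" "T z p c" "T y a c" "T z a b" "T x b c"
    using P pencil_fano[OF P] unfolding pencil_def by auto
  have "card {x, y, z, p, a, b, c} = 7" using distinct_card[OF d] by simp
  moreover have "\<exists>w\<in>{x, y, z, p, a, b, c}. T u v w"
    if "u \<in> {x, y, z, p, a, b, c}" "v \<in> {x, y, z, p, a, b, c}" "u \<noteq> v" for u v
    using that L by (elim insertE emptyE) (auto simp: T_perm)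
  ultimately show False by (rule no_fano)
qed

end

theorem theorem1:
  fixes V :: "'a set" and E :: "'a set set"
  assumes "linear_3_graph V E"
    and "V \<noteq> {}"
    and "min_degree V E \<ge> 4"
  shows "contains_crown E"
proof (rule ccontr)
  assume no_crown: "\<not> contains_crown E"
  have "finite V" using assms(1) unfolding linear_3_graph_def by blast
  then have deg: "4 \<le> degree E v" if "v \<in> V" for v
    using that assms(3) unfolding min_degree_def
    by (meson Min_le finite_imageI imageI order_trans)
  interpret crown_free V E
    using assms(1) deg no_crown by unfold_locales
  obtain v where "v \<in> V" using assms(2) by blast
  \<comment> \<open>A vertex of positive degree supplies the edge that \<open>no_edge\<close>
    forbids.\<close>
  then have "card {e \<in> E. v \<in> e} \<noteq> 0"
    using deg[of v] unfolding degree_def by simp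
  then have "{e \<in> E. v \<in> e} \<noteq> {}" by (metis card.empty)
  then obtain e where "e \<in> E" "v \<in> e" by blast
  then show False using edge_through no_edge by metis
qed

end
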